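(* Let $\mathcal{B},\mathcal{D}$ be complex Banach spaces and $T_t:\mathcal{D}\to\mathcal{B}$ ($t\ge 0$) a strongly continuous family of bounded operators with $\|T_0\|=1$, $\|T_t\|\le Ke^{\omega t}$ for some constants $K,\omega$ and all $t\ge 0$, and $\omega_0=0$. Let $a>0$ and $b\in\mathbf{R}$. If $a\|R_{a+ib}\|=c\ge 1$ and $r=a(1-1/c)$, then $$N(t)\ge\min\{e^{rt},c\}\qquad\text{for all } t\ge 0.$$
   Context: $\omega_0=\limsup_{t\to+\infty}t^{-1}\log\|T_t\|$. For $\mathrm{Re}(z)>0$, $R_z:\mathcal{D}\to\mathcal{B}$ is defined by $R_zf=\int_0^\infty (T_tf)e^{-zt}\,dt$ (when $T_t$ is a one-parameter semigroup this is the resolvent of its generator). $N(t)$ is the upper log-concave envelope of $\|T_t\|$: $N(t)=e^{\nu(t)}$, where $\nu$ is the smallest concave function on $[0,\infty)$ such that $\nu(t)\ge\log\|T_t\|$ for all $t\ge 0$. *)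

theory Defs
  imports "HOL-Analysis.Analysis"
begin

text \<open>
  Complex Banach spaces: real Banach spaces with a compatible complex scalar multiplication
  for which the norm is homogeneous over the complex numbers.
\<close>

class complex_banach = banach +
  fixes scaleC :: "complex \<Rightarrow> 'a \<Rightarrow> 'a"  (infixr "*\<^sub>C" 75)
  assumes scaleC_add_right: "c *\<^sub>C (x + y) = c *\<^sub>C x + c *\<^sub>C y"
    and scaleC_add_left: "(c + d) *\<^sub>C x = c *\<^sub>C x + d *\<^sub>C x"
    and scaleC_scaleC: "c *\<^sub>C (d *\<^sub>C x) = (c * d) *\<^sub>C x"
    and scaleC_of_real: "complex_of_real r *\<^sub>C x = r *\<^sub>R x"
    and norm_scaleC: "norm (c *\<^sub>C x) = cmod c * norm x"

instantiation complex :: complex_banach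
begin

definition scaleC_complex :: "complex \<Rightarrow> complex \<Rightarrow> complex" where
  "scaleC_complex c x = c * x"

instance
  by standard (simp_all add: scaleC_complex_def algebra_simps norm_mult scaleR_conv_of_real)

end

definition bounded_clinear :: "('d::complex_banach \<Rightarrow> 'b::complex_banach) \<Rightarrow> bool" where
  "bounded_clinear A \<longleftrightarrow> bounded_linear A \<and> (\<forall>c x. A (c *\<^sub>C x) = c *\<^sub>C A x)"

definition strongly_continuous :: "(real \<Rightarrow> 'd::complex_banach \<Rightarrow> 'b::complex_banach) \<Rightarrow> bool" where
  "strongly_continuous T \<longleftrightarrow> (\<forall>f. continuous_on {0..} (\<lambda>t. T t f))"

text \<open>
  The operator norm may vanish at some times, and its logarithm is then minus infinity,
  whereas the library has \<open>ln 0 = 0\<close>.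
\<close>

definition elog :: "real \<Rightarrow> ereal" where
  "elog x = (if x = 0 then -\<infinity> else ereal (ln x))"

definition growth_bound :: "(real \<Rightarrow> 'd::complex_banach \<Rightarrow> 'b::complex_banach) \<Rightarrow> ereal" where
  "growth_bound T = Limsup at_top (\<lambda>t. ereal (1 / t) * elog (onorm (T t)))"

text \<open>
  The integrand is continuous, and when the growth bound is zero and \<open>Re z > 0\<close> its norm decays
  exponentially; the Henstock-Kurzweil integral over the half line is then the usual absolutely
  convergent vector-valued integral. (The library's Bochner integral would need a separable
  target space.)
\<close>

definition resolvent ::
    "(real \<Rightarrow> 'd::complex_banach \<Rightarrow> 'b::complex_banach) \<Rightarrow> complex \<Rightarrow> 'd \<Rightarrow> 'b" where
  "resolvent T z f = integral {0..} (\<lambda>t. exp (- z * complex_of_real t) *\<^sub>C T t f)"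

definition smallest_concave_majorant :: "(real \<Rightarrow> ereal) \<Rightarrow> (real \<Rightarrow> real) \<Rightarrow> bool" where
  "smallest_concave_majorant \<phi> \<nu> \<longleftrightarrow>
     concave_on {0..} \<nu> \<and> (\<forall>t\<ge>0. \<phi> t \<le> ereal (\<nu> t)) \<and>
     (\<forall>\<mu>. concave_on {0..} \<mu> \<and> (\<forall>t\<ge>0. \<phi> t \<le> ereal (\<mu> t)) \<longrightarrow> (\<forall>t\<ge>0. \<nu> t \<le> \<mu> t))"

text \<open>
  A smallest concave majorant is unique on \<open>[0, \<infinity>)\<close> but arbitrary elsewhere, hence \<open>SOME\<close> rather
  than \<open>THE\<close>; the envelope is meaningful for \<open>t \<ge> 0\<close> only. Existence: an exponential bound on the
  operator norms gives an affine majorant, and growth bound zero makes the operators non-zero at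
  arbitrarily large times, which together with a non-zero operator at time zero bounds all concave
  majorants from below; the pointwise infimum of the majorants is then the smallest one.
\<close>

definition log_concave_envelope ::
    "(real \<Rightarrow> 'd::complex_banach \<Rightarrow> 'b::complex_banach) \<Rightarrow> real \<Rightarrow> real" where
  "log_concave_envelope T t =
     exp ((SOME \<nu>. smallest_concave_majorant (\<lambda>s. elog (onorm (T s))) \<nu>) t)"

end

theory Submission
  imports Defs
begin

text \<open>
  A supporting line of the envelope \<open>\<nu>\<close> at \<open>s > 0\<close> bounds \<open>\<parallel>T\<^sub>t\<parallel>\<close> by an exponential
  \<open>exp (\<nu> s + \<beta> (t - s))\<close>, and integrating it gives
  \<open>\<parallel>R\<^sub>z\<parallel> \<le> exp (\<nu> s - \<beta> s) / (a - \<beta>)\<close>. Here \<open>\<beta> \<ge> 0\<close> because the growth bound is zero, and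
  \<open>\<beta> s \<le> \<nu> s\<close> because \<open>\<nu> 0 \<ge> 0\<close>. If \<open>\<nu> s < min (r s) (ln c)\<close>, convexity of the exponential
  makes this bound strictly smaller than \<open>c / a\<close>, whichever \<open>\<beta>\<close> occurs.
\<close>

lemma elog_le_ereal_iff:
  assumes "x \<ge> 0"
  shows "elog x \<le> ereal y \<longleftrightarrow> x \<le> exp y"
proof (cases "x = 0")
  case False
  with assms have "x > 0" by simp
  then have "ln x \<le> y \<longleftrightarrow> x \<le> exp y" by (metis exp_ln exp_le_cancel_iff)
  with False show ?thesis by (simp add: elog_def)
qed (simp add: elog_def)

lemma concave_on_supporting_line:
  fixes f :: "real \<Rightarrow> real"
  assumes "concave_on S f" and "x \<in> interior S"
  obtains m where "\<And>y. y \<in> S \<Longrightarrow> f y \<le> f x + m * (y - x)"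
proof -
  \<comment> \<open>\<open>m\<close> is the right derivative at \<open>x\<close> of the convex
    function \<open>- f\<close>, as an infimum of chord slopes; the supporting slope for
    \<open>f\<close> is therefore \<open>- m\<close>.\<close>
  define m where "m = Inf ((\<lambda>t. (- f x - - f t) / (x - t)) ` ({x<..} \<inter> S))"
  have "f y \<le> f x + (- m) * (y - x)" if "y \<in> S" for y
    using convex_le_Inf_differential[OF assms(1)[unfolded concave_on_def] assms(2) that]
    by (simp add: m_def)
  then show thesis by (rule that)
qed

lemma concave_on_INF:
  fixes F :: "('a::real_vector \<Rightarrow> real) set"
  assumes "F \<noteq> {}" and "convex S" and concave: "\<And>f. f \<in> F \<Longrightarrow> concave_on S f"
    and bdd: "\<And>x. x \<in> S \<Longrightarrow> bdd_below ((\<lambda>f. f x) ` F)"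
  shows "concave_on S (\<lambda>x. INF f\<in>F. f x)"
  unfolding concave_on_iff
proof (intro conjI ballI allI impI \<open>convex S\<close>)
  fix x y and u v :: real
  assume xy: "x \<in> S" "y \<in> S" and uv: "u \<ge> 0" "v \<ge> 0" "u + v = 1"
  show "u * (INF f\<in>F. f x) + v * (INF f\<in>F. f y) \<le> (INF f\<in>F. f (u *\<^sub>R x + v *\<^sub>R y))"
  proof (rule cINF_greatest[OF \<open>F \<noteq> {}\<close>])
    fix f assume f: "f \<in> F"
    have "u * (INF f\<in>F. f x) + v * (INF f\<in>F. f y) \<le> u * f x + v * f y"
      using xy uv f by (intro add_mono mult_left_mono cINF_lower bdd) auto
    also have "\<dots> \<le> f (u *\<^sub>R x + v *\<^sub>R y)"
      using concave[OF f] xy uv by (auto simp: concave_on_iff)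
    finally show "u * (INF f\<in>F. f x) + v * (INF f\<in>F. f y) \<le> f (u *\<^sub>R x + v *\<^sub>R y)" .
  qed
qed

text \<open>After division by \<open>t\<close> the constant \<open>\<alpha>\<close> fades, so a
  negative slope would push the growth bound below zero.\<close>

lemma affine_majorant_slope_nonneg:
  assumes "growth_bound T = 0"
    and le: "\<And>t. t \<ge> t0 \<Longrightarrow> elog (onorm (T t)) \<le> ereal (\<alpha> + \<beta> * t)"
  shows "\<beta> \<ge> 0"
proof (rule ccontr)
  assume "\<not> \<beta> \<ge> 0"
  then have \<beta>: "\<beta> < 0" by simp
  \<comment> \<open>Beyond \<open>- 2 * \<alpha> / \<beta>\<close> the constant
    \<open>\<alpha>\<close> uses up at most half of the decay \<open>\<beta> * t\<close>; the 1 in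
    the maximum keeps \<open>t\<close> positive.\<close>
  have "\<forall>\<^sub>F t in at_top. ereal (1 / t) * elog (onorm (T t)) \<le> ereal (\<beta> / 2)"
    using eventually_ge_at_top[of "max 1 (max t0 (- 2 * \<alpha> / \<beta>))"]
  proof eventually_elim
    case (elim t)
    then have t: "t \<ge> 1" "t \<ge> t0" "- 2 * \<alpha> / \<beta> \<le> t" by auto
    have "ereal (1 / t) * elog (onorm (T t)) \<le> ereal (1 / t) * ereal (\<alpha> + \<beta> * t)"
      using t by (intro ereal_mult_left_mono le) auto
    also have "\<dots> \<le> ereal (\<beta> / 2)"
      using t \<beta> by (simp add: field_simps)
    finally show ?case .
  qed
  then have "growth_bound T \<le> ereal (\<beta> / 2)"
    unfolding growth_bound_def by (rule Limsup_bounded)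
  with assms(1) \<beta> show False by (simp add: zero_ereal_def)
qed

definition concave_majorant :: "(real \<Rightarrow> ereal) \<Rightarrow> (real \<Rightarrow> real) \<Rightarrow> bool" where
  "concave_majorant \<phi> \<mu> \<longleftrightarrow> concave_on {0..} \<mu> \<and> (\<forall>t\<ge>0. \<phi> t \<le> ereal (\<mu> t))"

text \<open>At 0 this is \<open>ln 1 = 0\<close>. At \<open>t > 0\<close> the supporting line
  dominates the log norms, so its slope is nonnegative, and its value at \<open>t\<close> is at
  least its value at 0, which is at least \<open>\<mu> 0\<close>. The endpoint 0 is treated apart
  because a supporting line is only guaranteed at interior points.\<close>

lemma concave_majorant_nonneg:
  assumes gb: "growth_bound T = 0" and T0: "onorm (T 0) = 1"
    and \<mu>: "concave_majorant (\<lambda>s. elog (onorm (T s))) \<mu>" and "t \<ge> 0"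
  shows "\<mu> t \<ge> 0"
proof (cases "t = 0")
  case True
  have "elog (onorm (T 0)) \<le> ereal (\<mu> 0)"
    using \<mu> by (simp add: concave_majorant_def)
  with True T0 show ?thesis by (simp add: elog_def)
next
  case False
  with \<open>t \<ge> 0\<close> have t: "t > 0" by simp
  have "elog (onorm (T 0)) \<le> ereal (\<mu> 0)"
    using \<mu> by (simp add: concave_majorant_def)
  with T0 have \<mu>0: "\<mu> 0 \<ge> 0" by (simp add: elog_def)
  have "concave_on {0..} \<mu>" using \<mu> by (simp add: concave_majorant_def)
  moreover have "t \<in> interior {0..}" using t by simp
  ultimately obtain m where m: "\<And>y. y \<in> {0..} \<Longrightarrow> \<mu> y \<le> \<mu> t + m * (y - t)"
    using concave_on_supporting_line by blast
  have "m \<ge> 0"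
  proof (rule affine_majorant_slope_nonneg[OF gb])
    fix y :: real assume "y \<ge> 0"
    then have "elog (onorm (T y)) \<le> ereal (\<mu> y)" using \<mu> by (simp add: concave_majorant_def)
    also have "\<dots> \<le> ereal ((\<mu> t - m * t) + m * y)" using m[of y] \<open>y \<ge> 0\<close> by (simp add: algebra_simps)
    finally show "elog (onorm (T y)) \<le> ereal ((\<mu> t - m * t) + m * y)" .
  qed
  then have "m * t \<ge> 0" using t by simp
  with m[of 0] \<mu>0 show ?thesis by simp
qed

text \<open>The witness is the pointwise infimum of all concave majorants:
  \<open>\<mu>\<^sub>0\<close> makes the family nonempty and \<open>nonneg\<close> bounds it below,
  so these real infima are genuine.\<close>

lemma ex_smallest_concave_majorant:
  assumes "concave_majorant \<phi> \<mu>\<^sub>0"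
    and nonneg: "\<And>\<mu> t. concave_majorant \<phi> \<mu> \<Longrightarrow> t \<ge> 0 \<Longrightarrow> \<mu> t \<ge> 0"
  shows "\<exists>\<nu>. smallest_concave_majorant \<phi> \<nu>"
proof -
  define F where "F = Collect (concave_majorant \<phi>)"
  define \<nu> where "\<nu> = (\<lambda>t. INF \<mu>\<in>F. \<mu> t)"
  have ne: "F \<noteq> {}" using assms(1) by (auto simp: F_def)
  have bdd: "bdd_below ((\<lambda>\<mu>. \<mu> t) ` F)" if "t \<ge> 0" for t
    using nonneg that by (auto simp: F_def intro!: bdd_belowI2[of _ 0])
  have "concave_on {0..} \<nu>"
    unfolding \<nu>_def using ne bdd
    by (intro concave_on_INF) (auto simp: F_def concave_majorant_def)
  moreover have "\<phi> t \<le> ereal (\<nu> t)" if "t \<ge> 0" for t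
  \<comment> \<open>Only finite values call on the infimum: plus infinity is excluded by
    \<open>\<mu>\<^sub>0\<close>, and minus infinity is trivial.\<close>
  proof (cases "\<phi> t")
    case (real x)
    have "x \<le> \<nu> t"
      unfolding \<nu>_def
    proof (rule cINF_greatest[OF ne])
      fix \<mu> assume "\<mu> \<in> F"
      with that have "\<phi> t \<le> ereal (\<mu> t)" by (simp add: F_def concave_majorant_def)
      with real show "x \<le> \<mu> t" by simp
    qed
    with real show ?thesis by simp
  next
    case PInf
    with assms(1) that show ?thesis by (auto simp: concave_majorant_def)
  qed simp
  moreover have "\<nu> t \<le> \<mu> t" if "concave_majorant \<phi> \<mu>" "t \<ge> 0" for \<mu> t
    unfolding \<nu>_def using that bdd by (intro cINF_lower) (auto simp: F_def)
  ultimately show ?thesis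
    unfolding smallest_concave_majorant_def concave_majorant_def by blast
qed

lemma onorm_resolvent_le:
  assumes lin: "\<And>t. t \<ge> 0 \<Longrightarrow> bounded_linear (T t)"
    and le: "\<And>t. t \<ge> 0 \<Longrightarrow> onorm (T t) \<le> exp (\<alpha> + \<beta> * t)"
    and "\<beta> < Re z"
  shows "onorm (resolvent T z) \<le> exp \<alpha> / (Re z - \<beta>)"
proof (rule onorm_bound)
  show "0 \<le> exp \<alpha> / (Re z - \<beta>)" using assms(3) by simp
  fix f
  let ?g = "\<lambda>t. exp (- z * complex_of_real t) *\<^sub>C T t f"
  let ?h = "\<lambda>t. exp \<alpha> * norm f * exp (- (Re z - \<beta>) * t)"
  have h: "(?h has_integral exp \<alpha> * norm f * (exp (- (Re z - \<beta>) * 0) / (Re z - \<beta>))) {0..}"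
    using assms(3) by (intro has_integral_mult_right has_integral_exp_minus_to_infinity) simp
  have gh: "norm (?g t) \<le> ?h t" if "t \<in> {0..}" for t
  proof -
    from that have t: "t \<ge> 0" by simp
    have "norm (?g t) = exp (- Re z * t) * norm (T t f)"
      by (simp add: norm_scaleC norm_exp_eq_Re)
    also have "\<dots> \<le> exp (- Re z * t) * (exp (\<alpha> + \<beta> * t) * norm f)"
      using order_trans[OF onorm[OF lin[OF t]] mult_right_mono[OF le[OF t] norm_ge_zero]]
      by (intro mult_left_mono) auto
    also have "\<dots> = ?h t"
      by (simp add: exp_add exp_diff exp_minus field_simps)
    finally show ?thesis .
  qed
  have "norm (integral {0..} ?g) \<le> exp \<alpha> * norm f / (Re z - \<beta>)"
  proof (cases "?g integrable_on {0..}")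
    case True
    have "norm (integral {0..} ?g) \<le> integral {0..} ?h"
      using True has_integral_integrable[OF h] gh by (rule integral_norm_bound_integral)
    also have "\<dots> = exp \<alpha> * norm f / (Re z - \<beta>)"
      using integral_unique[OF h] by simp
    finally show ?thesis .
  next
    \<comment> \<open>The integral of a non-integrable function is 0 by convention, which satisfies
      the bound.\<close>
    case False
    then show ?thesis using assms(3) by (simp add: not_integrable_integral)
  qed
  then show "norm (resolvent T z f) \<le> exp \<alpha> / (Re z - \<beta>) * norm f"
    by (simp add: resolvent_def)
qed

text \<open>Here \<open>y\<close> stands for the envelope at \<open>s\<close> and
  \<open>\<beta>\<close> for the slope of a supporting line there. The chord of \<open>exp\<close>
  from 0 to \<open>y\<close> replaces the exponential by an expression affine in
  \<open>\<beta>\<close>, which can be compared directly with \<open>a - \<beta>\<close>.\<close>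

lemma exp_tangent_bound:
  fixes a c r s y \<beta> :: real
  assumes "a > 0" "c \<ge> 1" and r: "r = a * (1 - 1 / c)"
    and "s > 0" "0 \<le> \<beta>" "\<beta> * s \<le> y" "y < r * s" "exp y < c"
  shows "\<beta> < a" and "exp (y - \<beta> * s) / (a - \<beta>) < c / a"
proof -
  have "\<beta> * s < r * s" using assms(6,7) by (rule le_less_trans)
  then have \<beta>r: "\<beta> < r" using \<open>s > 0\<close> by simp
  have "r \<le> a" using assms(1,2) unfolding r by (simp add: field_simps)
  with \<beta>r show "\<beta> < a" by simp
  \<comment> \<open>\<open>r\<close> is positive because \<open>0 \<le> \<beta> < r\<close>, so
    \<open>\<theta>\<close> measures \<open>\<beta>\<close> as a fraction of the critical
    slope.\<close>
  define \<theta> where "\<theta> = \<beta> / r"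
  have \<theta>: "0 \<le> \<theta>" "\<theta> < 1" "\<beta> = \<theta> * r" using \<beta>r \<open>0 \<le> \<beta>\<close> by (auto simp: \<theta>_def)
  have "\<theta> * y \<le> \<theta> * (r * s)" using \<theta> assms by (intro mult_left_mono) auto
  then have "exp (y - \<beta> * s) \<le> exp ((1 - \<theta>) * y)"
    using \<theta>(3) by (simp add: algebra_simps)
  \<comment> \<open>Convexity between 0 and \<open>y\<close>; the summand \<open>\<theta>\<close> is
    \<open>\<theta> * exp 0\<close>.\<close>
  also have "\<dots> \<le> (1 - \<theta>) * exp y + \<theta>"
    using convex_onD[OF exp_convex, of "1 - \<theta>" 0 y] \<theta> by simp
  also have "\<dots> < (1 - \<theta>) * c + \<theta>"
    using \<theta> \<open>exp y < c\<close> by simp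
  \<comment> \<open>This is where the value of \<open>r\<close> enters:
    \<open>r * c = a * (c - 1)\<close> gives
    \<open>\<theta> * (c - 1) = \<beta> * c / a\<close>.\<close>
  also have "\<dots> = c * (a - \<beta>) / a"
    using assms(1,2) \<theta>(3) unfolding r by (simp add: field_simps)
  finally show "exp (y - \<beta> * s) / (a - \<beta>) < c / a"
    using \<open>\<beta> < a\<close> \<open>a > 0\<close> by (simp add: field_simps)
qed

theorem theorem4:
  fixes T :: "real \<Rightarrow> 'd::complex_banach \<Rightarrow> 'b::complex_banach"
    and K \<omega> a b c r :: real
  assumes "\<And>t. t \<ge> 0 \<Longrightarrow> bounded_clinear (T t)"
    and "strongly_continuous T"
    and "onorm (T 0) = 1"
    and "\<And>t. t \<ge> 0 \<Longrightarrow> onorm (T t) \<le> K * exp (\<omega> * t)"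
    and "growth_bound T = 0"
    and "a > 0"
    and "a * onorm (resolvent T (Complex a b)) = c"
    and "c \<ge> 1"
    and "r = a * (1 - 1 / c)"
  shows "\<forall>t\<ge>0. log_concave_envelope T t \<ge> min (exp (r * t)) c"
proof (intro allI impI)
  fix s :: real assume "s \<ge> 0"
  let ?\<phi> = "\<lambda>s. elog (onorm (T s))"
  have lin: "bounded_linear (T t)" if "t \<ge> 0" for t
    using assms(1)[OF that] by (simp add: bounded_clinear_def)
  have onorm_nonneg: "onorm (T t) \<ge> 0" if "t \<ge> 0" for t
    using onorm_pos_le[OF lin[OF that]] .
  have nonneg: "\<mu> t \<ge> 0" if "concave_majorant ?\<phi> \<mu>" "t \<ge> 0" for \<mu> t
    using concave_majorant_nonneg[OF assms(5,3) that] .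
  \<comment> \<open>Positivity of \<open>K\<close> gives \<open>exp (ln K) = K\<close>, so the
    exponential bound becomes an affine majorant.\<close>
  have "K \<ge> 1" using assms(3) assms(4)[of 0] by simp
  have "concave_majorant ?\<phi> (\<lambda>t. ln K + \<omega> * t)"
    unfolding concave_majorant_def
  proof (intro conjI allI impI)
    show "concave_on {0..} (\<lambda>t. ln K + \<omega> * t)"
      unfolding concave_on_iff
    proof (intro conjI ballI allI impI)
      fix x y u v :: real
      assume "u + v = 1"
      then have "u * ln K + v * ln K = ln K" by (simp flip: distrib_right)
      then show "u * (ln K + \<omega> * x) + v * (ln K + \<omega> * y) \<le> ln K + \<omega> * (u *\<^sub>R x + v *\<^sub>R y)"
        by (simp add: algebra_simps)
    qed simp
    show "?\<phi> t \<le> ereal (ln K + \<omega> * t)" if "t \<ge> 0" for t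
      using assms(4)[OF that] \<open>K \<ge> 1\<close> by (simp add: elog_le_ereal_iff onorm_nonneg that exp_add)
  qed
  then have ex: "\<exists>\<nu>. smallest_concave_majorant ?\<phi> \<nu>"
    using nonneg by (rule ex_smallest_concave_majorant)
  define \<nu> where "\<nu> = (SOME \<nu>. smallest_concave_majorant ?\<phi> \<nu>)"
  have "smallest_concave_majorant ?\<phi> \<nu>"
    unfolding \<nu>_def using ex by (rule someI_ex)
  then have \<nu>: "concave_majorant ?\<phi> \<nu>"
    by (auto simp: smallest_concave_majorant_def concave_majorant_def)
  have "min (exp (r * s)) c \<le> exp (\<nu> s)"
  proof (rule ccontr)
    assume "\<not> min (exp (r * s)) c \<le> exp (\<nu> s)"
    then have less: "\<nu> s < r * s" "exp (\<nu> s) < c" by (auto simp: not_le)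
    \<comment> \<open>At \<open>s = 0\<close> the first inequality would read
      \<open>\<nu> 0 < 0\<close>; hence \<open>s\<close> is interior and a supporting line
      exists.\<close>
    with nonneg[OF \<nu> \<open>s \<ge> 0\<close>] \<open>s \<ge> 0\<close> have s: "s > 0" by (cases "s = 0") auto
    then have "s \<in> interior {0..}" by simp
    with \<nu> obtain \<beta> where \<beta>: "\<And>t. t \<in> {0..} \<Longrightarrow> \<nu> t \<le> \<nu> s + \<beta> * (t - s)"
      unfolding concave_majorant_def using concave_on_supporting_line by blast
    have affine: "?\<phi> t \<le> ereal ((\<nu> s - \<beta> * s) + \<beta> * t)" if "t \<ge> 0" for t
    proof -
      have "?\<phi> t \<le> ereal (\<nu> t)" using \<nu> that by (simp add: concave_majorant_def)
      also have "\<dots> \<le> ereal ((\<nu> s - \<beta> * s) + \<beta> * t)"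
        using \<beta>[of t] that by (simp add: algebra_simps)
      finally show ?thesis .
    qed
    have "\<beta> \<ge> 0"
      using assms(5) affine by (rule affine_majorant_slope_nonneg)
    moreover have "\<beta> * s \<le> \<nu> s" using \<beta>[of 0] nonneg[OF \<nu>, of 0] by simp
    ultimately have bound: "\<beta> < a" "exp (\<nu> s - \<beta> * s) / (a - \<beta>) < c / a"
      using exp_tangent_bound[OF assms(6,8,9) s _ _ less] by auto
    \<comment> \<open>Read back through \<open>elog\<close>, the affine bound is the exponential
      bound on the operator norms that the resolvent estimate requires, with decay guaranteed by
      \<open>\<beta> < a\<close>.\<close>
    have "onorm (resolvent T (Complex a b)) \<le> exp (\<nu> s - \<beta> * s) / (Re (Complex a b) - \<beta>)"
      using lin affine bound(1)
      by (intro onorm_resolvent_le) (auto simp: elog_le_ereal_iff onorm_nonneg)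
    also have "\<dots> < c / a" using bound(2) by simp
    finally show False using assms(6,7) by (simp add: field_simps)
  qed
  then show "min (exp (r * s)) c \<le> log_concave_envelope T s"
    by (simp add: log_concave_envelope_def \<nu>_def)
qed

end
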